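(* Let $\widehat H$ be a self-adjoint operator with discrete spectrum, with distinct eigenvalues $E_n$ of finite multiplicity $\kappa_n$ and an orthonormal basis of eigenvectors $\Omega_{n,k}$, $k=1,\dots,\kappa_n$, $\widehat H\Omega_{n,k}=E_n\Omega_{n,k}$. Let $E\in\mathbb{R}$ and let $\widehat A$ be an observable whose diagonal matrix elements $\langle\Omega_{n,k}|\widehat A|\Omega_{n,k}\rangle$ are defined. Suppose that for some $\varepsilon_0>0$ $$\sum_{n}\kappa_n\exp\!\Big[-\frac{(E_n-E)^2}{2\varepsilon_0^2}\Big]<\infty\quad\text{and}\quad \sum_{n,k}\exp\!\Big[-\frac{(E_n-E)^2}{2\varepsilon_0^2}\Big]\,\big|\langle\Omega_{n,k}|\widehat A|\Omega_{n,k}\rangle\big|<\infty .$$ Then $$\lim_{\varepsilon\to0^+}\langle\widehat A\rangle_\varepsilon=\frac{1}{M}\sum_{n:\,|E_n-E|=d}\ \sum_{k=1}^{\kappa_n}\langle\Omega_{n,k}|\widehat A|\Omega_{n,k}\rangle ,$$ where $d=\min_n|E_n-E|$ and $M=\sum_{n:\,|E_n-E|=d}\kappa_n$. That is, the limit is the average of the expectation values of $\widehat A$ over the energy eigenstates whose eigenvalue is nearest to $E$; in particular, if $E=E_{n_0}$ is an eigenvalue, the limit is the microcanonical expectation value $\kappa_{n_0}^{-1}\sum_{k}\langle\Omega_{n_0,k}|\widehat A|\Omega_{n_0,k}\rangle$.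
   Context: The Gaussian ensemble at energy $E$ with width $\varepsilon>0$ is given by the operator $\widehat\rho_\varepsilon(E)=\frac{1}{\sqrt{2\pi\varepsilon^2}}\exp\big[-\frac12\big(\frac{\widehat H-E}{\varepsilon}\big)^2\big]$, and its expectation values are $\langle\widehat A\rangle_\varepsilon=\mathrm{Tr}(\widehat\rho_\varepsilon\widehat A)/\mathrm{Tr}\,\widehat\rho_\varepsilon$, where the traces are computed in the eigenbasis: $$\mathrm{Tr}(\widehat\rho_\varepsilon\widehat A)=\frac{1}{\sqrt{2\pi\varepsilon^2}}\sum_{n,k}\exp\!\Big[-\frac{(E_n-E)^2}{2\varepsilon^2}\Big]\langle\Omega_{n,k}|\widehat A|\Omega_{n,k}\rangle ,\qquad \mathrm{Tr}\,\widehat\rho_\varepsilon=\frac{1}{\sqrt{2\pi\varepsilon^2}}\sum_n\kappa_n\exp\!\Big[-\frac{(E_n-E)^2}{2\varepsilon^2}\Big].$$ *)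

theory Defs
  imports "HOL-Analysis.Analysis"
begin

(* Complex Hilbert spaces; the inner product is linear in its second argument. The last axiom
   says that the norm of the underlying (complete) normed space is the Hilbert space norm, and so
   contains positive definiteness. *)
class complex_hilbert_space = banach +
  fixes scaleC :: "complex \<Rightarrow> 'a \<Rightarrow> 'a"
    and cinner :: "'a \<Rightarrow> 'a \<Rightarrow> complex"
  assumes scaleC_add_right: "scaleC a (x + y) = scaleC a x + scaleC a y"
    and scaleC_add_left: "scaleC (a + b) x = scaleC a x + scaleC b x"
    and scaleC_scaleC: "scaleC a (scaleC b x) = scaleC (a * b) x"
    and scaleR_scaleC: "scaleR r x = scaleC (complex_of_real r) x"
    and cinner_commute: "cinner x y = cnj (cinner y x)"
    and cinner_add_right: "cinner x (y + z) = cinner x y + cinner x z"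
    and cinner_scaleC_right: "cinner x (scaleC a y) = a * cinner x y"
    and cinner_self: "cinner x x = complex_of_real ((norm x)\<^sup>2)"

global_interpretation complex_vector:
  vector_space "scaleC :: complex \<Rightarrow> 'a \<Rightarrow> 'a::complex_hilbert_space"
proof
  fix a b :: complex and x y :: 'a
  show "scaleC a (x + y) = scaleC a x + scaleC a y" by (rule scaleC_add_right)
  show "scaleC (a + b) x = scaleC a x + scaleC b x" by (rule scaleC_add_left)
  show "scaleC a (scaleC b x) = scaleC (a * b) x" by (rule scaleC_scaleC)
  show "scaleC 1 x = x" using scaleR_scaleC[of 1 x] by simp
qed

(* A possibly unbounded operator is given by its domain D and a function T, of which only the
   values on D matter. *)

definition linear_operator :: "'a::complex_hilbert_space set \<Rightarrow> ('a \<Rightarrow> 'a) \<Rightarrow> bool" where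
  "linear_operator D T \<longleftrightarrow> complex_vector.subspace D \<and>
     (\<forall>x\<in>D. \<forall>y\<in>D. T (x + y) = T x + T y) \<and>
     (\<forall>a. \<forall>x\<in>D. T (scaleC a x) = scaleC a (T x))"

definition densely_defined_operator :: "'a::complex_hilbert_space set \<Rightarrow> ('a \<Rightarrow> 'a) \<Rightarrow> bool" where
  "densely_defined_operator D T \<longleftrightarrow> linear_operator D T \<and> closure D = UNIV"

definition symmetric_operator :: "'a::complex_hilbert_space set \<Rightarrow> ('a \<Rightarrow> 'a) \<Rightarrow> bool" where
  "symmetric_operator D T \<longleftrightarrow> densely_defined_operator D T \<and>
     (\<forall>x\<in>D. \<forall>y\<in>D. cinner (T x) y = cinner x (T y))"

definition operator_graph :: "'a set \<Rightarrow> ('a \<Rightarrow> 'a) \<Rightarrow> ('a \<times> 'a) set" where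
  "operator_graph D T = {(x, T x) | x. x \<in> D}"

definition adjoint_graph :: "'a::complex_hilbert_space set \<Rightarrow> ('a \<Rightarrow> 'a) \<Rightarrow> ('a \<times> 'a) set" where
  "adjoint_graph D T = {(y, z). \<forall>x\<in>D. cinner y (T x) = cinner z x}"

definition self_adjoint :: "'a::complex_hilbert_space set \<Rightarrow> ('a \<Rightarrow> 'a) \<Rightarrow> bool" where
  "self_adjoint D T \<longleftrightarrow> densely_defined_operator D T \<and> adjoint_graph D T = operator_graph D T"

definition resolvent_set :: "'a::complex_hilbert_space set \<Rightarrow> ('a \<Rightarrow> 'a) \<Rightarrow> complex set" where
  "resolvent_set D T = {z. bij_betw (\<lambda>x. T x - scaleC z x) D UNIV \<and>
     (\<exists>C. \<forall>x\<in>D. norm x \<le> C * norm (T x - scaleC z x))}"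

definition spectrum :: "'a::complex_hilbert_space set \<Rightarrow> ('a \<Rightarrow> 'a) \<Rightarrow> complex set" where
  "spectrum D T = - resolvent_set D T"

definition eigenspace :: "'a::complex_hilbert_space set \<Rightarrow> ('a \<Rightarrow> 'a) \<Rightarrow> complex \<Rightarrow> 'a set" where
  "eigenspace D T z = {x \<in> D. T x = scaleC z x}"

definition eigenvalues :: "'a::complex_hilbert_space set \<Rightarrow> ('a \<Rightarrow> 'a) \<Rightarrow> complex set" where
  "eigenvalues D T = {z. \<exists>x\<in>eigenspace D T z. x \<noteq> 0}"

definition discrete_spectrum :: "'a::complex_hilbert_space set \<Rightarrow> ('a \<Rightarrow> 'a) \<Rightarrow> bool" where
  "discrete_spectrum D T \<longleftrightarrow> (\<forall>z\<in>spectrum D T. z isolated_in spectrum D T \<and>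
     z \<in> eigenvalues D T \<and> (\<exists>B. finite B \<and> eigenspace D T z = complex_vector.span B))"

definition multiplicity_of :: "'a::complex_hilbert_space set \<Rightarrow> ('a \<Rightarrow> 'a) \<Rightarrow> complex \<Rightarrow> nat" where
  "multiplicity_of D T z = complex_vector.dim (eigenspace D T z)"

definition orthonormal_basis :: "'i set \<Rightarrow> ('i \<Rightarrow> 'a::complex_hilbert_space) \<Rightarrow> bool" where
  "orthonormal_basis J b \<longleftrightarrow>
     (\<forall>i\<in>J. \<forall>j\<in>J. cinner (b i) (b j) = (if i = j then 1 else 0)) \<and>
     closure (complex_vector.span (b ` J)) = UNIV"

(* The function f of the operator that has the orthonormal eigenbasis (b j), j in J, with
   eigenvalues e j (functional calculus). *)
definition spectral_function ::
  "'i set \<Rightarrow> ('i \<Rightarrow> real) \<Rightarrow> ('i \<Rightarrow> 'a::complex_hilbert_space) \<Rightarrow> (real \<Rightarrow> real) \<Rightarrow> 'a \<Rightarrow> 'a" where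
  "spectral_function J e b f x =
     (\<Sum>\<^sub>\<infinity>j\<in>J. scaleC (complex_of_real (f (e j))) (scaleC (cinner (b j) x) (b j)))"

definition trace_in :: "'i set \<Rightarrow> ('i \<Rightarrow> 'a::complex_hilbert_space) \<Rightarrow> ('a \<Rightarrow> 'a) \<Rightarrow> complex" where
  "trace_in J b T = (\<Sum>\<^sub>\<infinity>j\<in>J. cinner (b j) (T (b j)))"

(* Pairs (n, k) labelling the eigenvectors, k = 1, ..., kappa n. *)
definition eigen_index :: "nat set \<Rightarrow> (nat \<Rightarrow> nat) \<Rightarrow> (nat \<times> nat) set" where
  "eigen_index I \<kappa> = (SIGMA n:I. {1..\<kappa> n})"

definition gaussian_density_op ::
  "nat set \<Rightarrow> (nat \<Rightarrow> nat) \<Rightarrow> (nat \<Rightarrow> real) \<Rightarrow> (nat \<times> nat \<Rightarrow> 'a::complex_hilbert_space) \<Rightarrow>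
     real \<Rightarrow> real \<Rightarrow> 'a \<Rightarrow> 'a" where
  "gaussian_density_op I \<kappa> En \<Omega> E \<epsilon> =
     spectral_function (eigen_index I \<kappa>) (\<lambda>j. En (fst j)) \<Omega>
       (\<lambda>t. 1 / sqrt (2 * pi * \<epsilon>\<^sup>2) * exp (- (1 / 2) * ((t - E) / \<epsilon>)\<^sup>2))"

definition gaussian_expectation ::
  "nat set \<Rightarrow> (nat \<Rightarrow> nat) \<Rightarrow> (nat \<Rightarrow> real) \<Rightarrow> (nat \<times> nat \<Rightarrow> 'a::complex_hilbert_space) \<Rightarrow>
     real \<Rightarrow> ('a \<Rightarrow> 'a) \<Rightarrow> real \<Rightarrow> complex" where
  "gaussian_expectation I \<kappa> En \<Omega> E A \<epsilon> =
     trace_in (eigen_index I \<kappa>) \<Omega> (gaussian_density_op I \<kappa> En \<Omega> E \<epsilon> \<circ> A) /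
     trace_in (eigen_index I \<kappa>) \<Omega> (gaussian_density_op I \<kappa> En \<Omega> E \<epsilon>)"

end

theory Submission
  imports Defs "HOL-Real_Asymp.Real_Asymp"
begin

text \<open>Relative to the eigenbasis the density operator is diagonal, so both traces are sums over the
  eigenvectors with Gaussian weights. Multiplying numerator and denominator by
  \<open>exp (d\<^sup>2 / (2 * \<epsilon>\<^sup>2))\<close> turns the weights into \<open>exp (- ((En n - E)\<^sup>2 - d\<^sup>2) / (2 * \<epsilon>\<^sup>2))\<close>, which
  increase with \<open>\<epsilon>\<close>, hence are dominated by their summable values at \<open>\<epsilon>\<^sub>0\<close>, and which tend to 1 if
  \<open>\<bar>En n - E\<bar> = d\<close> and to 0 otherwise. Dominated convergence gives the limit.\<close>

lemma cinner_diff_right: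
  fixes x y z :: "'a::complex_hilbert_space"
  shows "cinner x (y - z) = cinner x y - cinner x z"
  using cinner_add_right[of x "y - z" z] by simp

lemma cinner_scaleC_left:
  fixes x y :: "'a::complex_hilbert_space"
  shows "cinner (scaleC a x) y = cnj a * cinner x y"
  by (metis cinner_commute cinner_scaleC_right complex_cnj_mult)

lemma cinner_diff_left:
  fixes x y z :: "'a::complex_hilbert_space"
  shows "cinner (y - z) x = cinner y x - cinner z x"
  by (metis cinner_commute cinner_diff_right complex_cnj_diff)

text \<open>The underlying normed space gives homogeneity for real scalars only; for complex ones it
  comes from \<open>cinner_self\<close>, by comparing squares of nonnegative reals.\<close>

lemma norm_scaleC:
  fixes x :: "'a::complex_hilbert_space"
  shows "norm (scaleC a x) = cmod a * norm x"
proof -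
  have "complex_of_real ((norm (scaleC a x))\<^sup>2) = (a * cnj a) * cinner x x"
    using cinner_self[of "scaleC a x"]
    by (simp add: cinner_scaleC_left cinner_scaleC_right mult_ac)
  also have "\<dots> = complex_of_real ((cmod a * norm x)\<^sup>2)"
    by (simp add: cinner_self complex_norm_square[symmetric] power_mult_distrib)
  finally show ?thesis
    by (simp only: of_real_eq_iff power2_eq_iff_nonneg norm_ge_zero mult_nonneg_nonneg)
qed

lemma cinner_Cauchy_Schwarz:
  fixes x y :: "'a::complex_hilbert_space"
  shows "cmod (cinner x y) \<le> norm x * norm y"
proof (cases "x = 0")
  case True
  have "cinner y 0 = 0"
    using cinner_add_right[of y 0 0] by simp
  then show ?thesis
    using True by (metis cinner_commute complex_cnj_zero norm_zero mult_zero_left order_refl)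
next
  case False
  define c where "c = cinner x y"
  define n where "n = (norm x)\<^sup>2"
  have n: "n > 0" using False by (simp add: n_def)
  have yx: "cinner y x = cnj c" by (metis c_def cinner_commute)
  \<comment> \<open>\<open>v\<close> is \<open>n\<close> times the component of \<open>y\<close>
    orthogonal to \<open>x\<close>. Scaling by \<open>n\<close> avoids a division, and the
    inequality is the nonnegativity of the squared norm of \<open>v\<close>.\<close>
  define v where "v = scaleC (complex_of_real n) y - scaleC c x"
  have "complex_of_real ((norm v)\<^sup>2) = cinner v v" by (simp add: cinner_self)
  also have "\<dots> = of_real n * of_real n * cinner y y - of_real n * (c * cnj c)"
    unfolding v_def
    by (simp add: cinner_diff_left cinner_diff_right cinner_scaleC_left cinner_scaleC_right yx
        c_def[symmetric] cinner_self[of x] n_def[symmetric] algebra_simps)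
  also have "\<dots> = complex_of_real (n * (n * (norm y)\<^sup>2 - (cmod c)\<^sup>2))"
    by (simp add: cinner_self complex_norm_square[symmetric] algebra_simps)
  finally have "(norm v)\<^sup>2 = n * (n * (norm y)\<^sup>2 - (cmod c)\<^sup>2)"
    by (simp only: of_real_eq_iff)
  then have "0 \<le> n * (n * (norm y)\<^sup>2 - (cmod c)\<^sup>2)"
    by (metis zero_le_power2)
  then have "(cmod c)\<^sup>2 \<le> (norm x * norm y)\<^sup>2"
    using n by (simp add: zero_le_mult_iff n_def power_mult_distrib)
  then show ?thesis
    unfolding c_def by (rule power2_le_imp_le) simp
qed

text \<open>Cauchy-Schwarz supplies the bound. The continuity is what allows an inner product to be
  moved inside an infinite sum.\<close>

lemma bounded_linear_cinner_right:
  fixes x :: "'a::complex_hilbert_space"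
  shows "bounded_linear (cinner x)"
proof (rule bounded_linear_intro)
  show "cinner x (r *\<^sub>R y) = r *\<^sub>R cinner x y" for r y
    by (simp add: scaleR_scaleC cinner_scaleC_right scaleR_conv_of_real)
  show "norm (cinner x y) \<le> norm y * norm x" for y
    using cinner_Cauchy_Schwarz[of x y] by (simp add: mult.commute)
qed (rule cinner_add_right)

text \<open>Summability of \<open>f\<close> over the eigenvalues makes the defining series converge absolutely; the
  junk value 0 of a divergent infinite sum therefore plays no role.\<close>
lemma cinner_spectral_function:
  fixes b :: "'i \<Rightarrow> 'a::complex_hilbert_space"
  assumes b: "\<And>i j. i \<in> J \<Longrightarrow> j \<in> J \<Longrightarrow> cinner (b i) (b j) = (if i = j then 1 else 0)"
    and f: "(\<lambda>j. \<bar>f (e j)\<bar>) summable_on J"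
    and j: "j \<in> J"
  shows "cinner (b j) (spectral_function J e b f x) = of_real (f (e j)) * cinner (b j) x"
proof -
  let ?t = "\<lambda>i. scaleC (complex_of_real (f (e i))) (scaleC (cinner (b i) x) (b i))"
  have nb: "norm (b i) = 1" if "i \<in> J" for i
  proof -
    have "complex_of_real ((norm (b i))\<^sup>2) = of_real 1"
      using cinner_self[of "b i"] b[OF that that] by simp
    then have "(norm (b i))\<^sup>2 = 1" by (simp only: of_real_eq_iff)
    then show ?thesis by (metis norm_ge_zero one_power2 power2_eq_imp_eq zero_le_one)
  qed
  \<comment> \<open>The basis vectors have norm 1, so Cauchy-Schwarz bounds each coefficient by
    \<open>norm x\<close>.\<close>
  have "(\<lambda>i. norm (?t i)) summable_on J"
  proof (rule summable_on_comparison_test)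
    show "(\<lambda>i. norm x * \<bar>f (e i)\<bar>) summable_on J"
      by (intro summable_on_cmult_right f)
    show "norm (?t i) \<le> norm x * \<bar>f (e i)\<bar>" if "i \<in> J" for i
      using cinner_Cauchy_Schwarz[of "b i" x] nb[OF that]
      using mult_right_mono[of "cmod (cinner (b i) x)" "norm x" "\<bar>f (e i)\<bar>"]
      by (simp add: norm_scaleC norm_mult mult.commute)
  qed simp
  then have "?t summable_on J" by (rule abs_summable_summable)
  then have "((\<lambda>i. cinner (b j) (?t i)) has_sum cinner (b j) (spectral_function J e b f x)) J"
    unfolding spectral_function_def
    by (intro has_sum_bounded_linear[OF bounded_linear_cinner_right] has_sum_infsum)
  then have "cinner (b j) (spectral_function J e b f x) = (\<Sum>\<^sub>\<infinity>i\<in>J. cinner (b j) (?t i))"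
    by (rule infsumI[symmetric])
  also have "\<dots> = (\<Sum>\<^sub>\<infinity>i\<in>{j}. cinner (b j) (?t i))"
    using j by (intro infsum_cong_neutral) (auto simp: cinner_scaleC_right b)
  also have "\<dots> = of_real (f (e j)) * cinner (b j) x"
    using j by (simp add: cinner_scaleC_right b)
  finally show ?thesis .
qed

text \<open>By the Weierstrass M-test the finite partial sums converge to the infinite sum uniformly
  in \<open>t\<close>, and every finite sum has its termwise limit, so the two limits may be
  interchanged.\<close>

lemma infsum_dominated_convergence_at_right:
  fixes f :: "real \<Rightarrow> 'i \<Rightarrow> 'b::banach"
  assumes lim: "\<And>j. j \<in> J \<Longrightarrow> ((\<lambda>t. f t j) \<longlongrightarrow> L j) (at_right a)"
    and g: "g summable_on J"
    and bound: "\<And>t j. a < t \<Longrightarrow> t \<le> c \<Longrightarrow> j \<in> J \<Longrightarrow> norm (f t j) \<le> g j"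
    and "a < c"
  shows "((\<lambda>t. infsum (f t) J) \<longlongrightarrow> infsum L J) (at_right a)"
proof -
  \<comment> \<open>Uniformity holds only on a set where the majorant applies, so the one-sided
    filter is rewritten as a filter within that set.\<close>
  have eq: "at a within {a<..c} = at_right a"
    using \<open>a < c\<close> by (intro at_within_nhd[of _ "{..<c}"]) auto
  have ev: "\<forall>\<^sub>F t in at_right a. t \<le> c"
    using \<open>a < c\<close> by (auto simp: eventually_at_right_field)
  \<comment> \<open>The limit inherits the majorant. Hence \<open>L\<close> is summable and
    \<open>infsum L J\<close> is a genuine limit of finite sums, not the default value 0.\<close>
  have L: "norm (L j) \<le> g j" if "j \<in> J" for j
  proof (rule tendsto_upperbound)
    show "((\<lambda>t. norm (f t j)) \<longlongrightarrow> norm (L j)) (at_right a)"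
      using lim[OF that] by (rule tendsto_norm)
    show "\<forall>\<^sub>F t in at_right a. norm (f t j) \<le> g j"
      using ev eventually_at_right_less[of a] by eventually_elim (use bound that in auto)
  qed simp
  have "(\<lambda>j. norm (L j)) summable_on J"
    using g by (rule summable_on_comparison_test) (auto simp: L)
  then have "L summable_on J" by (rule abs_summable_summable)
  then have "(sum L \<longlongrightarrow> infsum L J) (finite_subsets_at_top J)"
    using has_sum_infsum unfolding has_sum_def by blast
  moreover have "uniform_limit {a<..c} (\<lambda>F t. \<Sum>j\<in>F. f t j) (\<lambda>t. infsum (f t) J)
      (finite_subsets_at_top J)"
    by (rule Weierstrass_m_test_general[OF _ g]) (use bound in auto)
  moreover have "\<forall>\<^sub>F F in finite_subsets_at_top J.
      ((\<lambda>t. \<Sum>j\<in>F. f t j) \<longlongrightarrow> sum L F) (at a within {a<..c})"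
    unfolding eq by (rule eventually_finite_subsets_at_top_weakI) (auto intro!: tendsto_sum lim)
  ultimately have "((\<lambda>t. infsum (f t) J) \<longlongrightarrow> infsum L J) (at a within {a<..c})"
    by (intro swap_uniform_limit[where F = "finite_subsets_at_top J"]) auto
  then show ?thesis by (simp only: eq)
qed

text \<open>By comparison the constant \<open>c\<close> is summable over the set in question, and a
  positive constant is summable over finite sets only.\<close>

lemma finite_large_terms_if_summable:
  fixes f :: "'i \<Rightarrow> real"
  assumes "f summable_on I" "\<And>i. i \<in> I \<Longrightarrow> f i \<ge> 0" "c > 0"
  shows "finite {i\<in>I. c \<le> f i}"
proof -
  have "f summable_on {i\<in>I. c \<le> f i}"
    using assms(1) by (rule summable_on_subset_banach) auto
  then have "(\<lambda>i. c) summable_on {i\<in>I. c \<le> f i}"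
    by (rule summable_on_comparison_test) (use assms(3) in auto)
  then show ?thesis 
    using \<open>c > 0\<close> infsum_diverge_constant[of "{i\<in>I. c \<le> f i}" c] by blast
qed

text \<open>This is the Gaussian weight at distance \<open>x\<close> relative to the weight at the
  minimal distance \<open>d\<close>: the exponent is constantly 0 if they agree and tends to minus
  infinity otherwise.\<close>

lemma gaussian_ratio_tendsto:
  fixes x d :: real
  assumes "d \<le> x" "0 \<le> d"
  shows "((\<lambda>\<epsilon>. exp (- ((x\<^sup>2 - d\<^sup>2) / (2 * \<epsilon>\<^sup>2)))) \<longlongrightarrow> (if x = d then 1 else 0)) (at_right 0)"
proof (cases "x = d")
  case False
  then have "x\<^sup>2 - d\<^sup>2 > 0" using assms by (simp add: power_strict_mono)
  then have "((\<lambda>\<epsilon>. exp (- ((x\<^sup>2 - d\<^sup>2) / (2 * \<epsilon>\<^sup>2)))) \<longlongrightarrow> 0) (at_right 0)"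
    by real_asymp
  then show ?thesis using False by simp
qed simp

lemma exp_neg_divide_mono:
  fixes y \<epsilon> \<epsilon>\<^sub>0 :: real
  assumes "0 \<le> y" "0 < \<epsilon>" "\<epsilon> \<le> \<epsilon>\<^sub>0"
  shows "exp (- (y / (2 * \<epsilon>\<^sup>2))) \<le> exp (- (y / (2 * \<epsilon>\<^sub>0\<^sup>2)))"
proof -
  have "\<epsilon>\<^sup>2 \<le> \<epsilon>\<^sub>0\<^sup>2" using assms by (intro power_mono) auto
  then have "y / (2 * \<epsilon>\<^sub>0\<^sup>2) \<le> y / (2 * \<epsilon>\<^sup>2)"
    using assms by (intro divide_left_mono) auto
  then show ?thesis by simp
qed

text \<open>Serves twice: with \<open>a\<close> the diagonal matrix elements it treats the numerator
  of the expectation, with \<open>a\<close> constantly 1 the denominator.\<close>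

lemma infsum_gaussian_ratio_tendsto:
  fixes x :: "'i \<Rightarrow> real" and a :: "'i \<Rightarrow> complex"
  assumes x: "\<And>j. j \<in> J \<Longrightarrow> d \<le> x j" and "0 \<le> d" "0 < \<epsilon>\<^sub>0"
    and sm: "(\<lambda>j. exp (- ((x j)\<^sup>2 / (2 * \<epsilon>\<^sub>0\<^sup>2))) * cmod (a j)) summable_on J"
    and fin: "finite {j\<in>J. x j = d}"
  shows "((\<lambda>\<epsilon>. \<Sum>\<^sub>\<infinity>j\<in>J. of_real (exp (- (((x j)\<^sup>2 - d\<^sup>2) / (2 * \<epsilon>\<^sup>2)))) * a j)
    \<longlongrightarrow> (\<Sum>j\<in>{j\<in>J. x j = d}. a j)) (at_right 0)"
proof -
  have "((\<lambda>\<epsilon>. \<Sum>\<^sub>\<infinity>j\<in>J. of_real (exp (- (((x j)\<^sup>2 - d\<^sup>2) / (2 * \<epsilon>\<^sup>2)))) * a j)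
    \<longlongrightarrow> (\<Sum>\<^sub>\<infinity>j\<in>J. of_real (if x j = d then 1 else 0) * a j)) (at_right 0)"
  proof (rule infsum_dominated_convergence_at_right)
    show "((\<lambda>\<epsilon>. of_real (exp (- (((x j)\<^sup>2 - d\<^sup>2) / (2 * \<epsilon>\<^sup>2)))) * a j)
        \<longlongrightarrow> of_real (if x j = d then 1 else 0) * a j) (at_right 0)" if "j \<in> J" for j
      by (intro tendsto_mult tendsto_of_real tendsto_const gaussian_ratio_tendsto x that \<open>0 \<le> d\<close>)
    \<comment> \<open>The assumption \<open>sm\<close> concerns weights not yet divided by the
      weight at \<open>d\<close>; the constant factor in front makes up for that division.\<close>
    show "(\<lambda>j. exp (d\<^sup>2 / (2 * \<epsilon>\<^sub>0\<^sup>2)) * (exp (- ((x j)\<^sup>2 / (2 * \<epsilon>\<^sub>0\<^sup>2))) * cmod (a j))) summable_on J"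
      by (intro summable_on_cmult_right sm)
    show "norm (of_real (exp (- (((x j)\<^sup>2 - d\<^sup>2) / (2 * \<epsilon>\<^sup>2)))) * a j)
        \<le> exp (d\<^sup>2 / (2 * \<epsilon>\<^sub>0\<^sup>2)) * (exp (- ((x j)\<^sup>2 / (2 * \<epsilon>\<^sub>0\<^sup>2))) * cmod (a j))"
      if "0 < \<epsilon>" "\<epsilon> \<le> \<epsilon>\<^sub>0" "j \<in> J" for \<epsilon> j
    proof -
      have "d\<^sup>2 \<le> (x j)\<^sup>2" using x[OF \<open>j \<in> J\<close>] \<open>0 \<le> d\<close> by (intro power_mono) auto
      then have "exp (- (((x j)\<^sup>2 - d\<^sup>2) / (2 * \<epsilon>\<^sup>2))) \<le> exp (- (((x j)\<^sup>2 - d\<^sup>2) / (2 * \<epsilon>\<^sub>0\<^sup>2)))"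
        using that by (intro exp_neg_divide_mono) auto
      also have "\<dots> = exp (d\<^sup>2 / (2 * \<epsilon>\<^sub>0\<^sup>2)) * exp (- ((x j)\<^sup>2 / (2 * \<epsilon>\<^sub>0\<^sup>2)))"
        by (simp add: exp_add[symmetric] diff_divide_distrib)
      finally show ?thesis
        by (simp add: norm_mult mult.assoc[symmetric] mult_right_mono)
    qed
  qed fact
  also have "(\<Sum>\<^sub>\<infinity>j\<in>J. of_real (if x j = d then 1 else 0) * a j) = infsum a {j\<in>J. x j = d}"
    by (rule infsum_cong_neutral) auto
  finally show ?thesis using fin by simp
qed

text \<open>Infinite sums, quotients and \<open>LEAST\<close> are total functions with default
  values. The conclusion therefore also asserts that the minimum is attained, that both trace series
  converge and that the denominator is nonzero, so that the limit concerns the intended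
  quantities.\<close>

theorem mainTheorem1:
  fixes D\<^sub>H D\<^sub>A :: "'a::complex_hilbert_space set"
    and H A :: "'a \<Rightarrow> 'a"
    and I :: "nat set"
    and En :: "nat \<Rightarrow> real"
    and \<kappa> :: "nat \<Rightarrow> nat"
    and \<Omega> :: "nat \<times> nat \<Rightarrow> 'a"
    and E \<epsilon>\<^sub>0 d :: real
    and M :: nat
  assumes "self_adjoint D\<^sub>H H"
    and "discrete_spectrum D\<^sub>H H"
    and "I \<noteq> {}"
    and "bij_betw (\<lambda>n. complex_of_real (En n)) I (eigenvalues D\<^sub>H H)"
    and "\<forall>n\<in>I. \<kappa> n = multiplicity_of D\<^sub>H H (complex_of_real (En n)) \<and> \<kappa> n > 0"
    and "orthonormal_basis (eigen_index I \<kappa>) \<Omega>"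
    and "\<forall>n\<in>I. \<forall>k\<in>{1..\<kappa> n}. \<Omega> (n, k) \<in> D\<^sub>H \<and>
           H (\<Omega> (n, k)) = scaleC (complex_of_real (En n)) (\<Omega> (n, k))"
    and "symmetric_operator D\<^sub>A A"
    and "\<forall>n\<in>I. \<forall>k\<in>{1..\<kappa> n}. \<Omega> (n, k) \<in> D\<^sub>A"
    and "\<epsilon>\<^sub>0 > 0"
    and "(\<lambda>n. real (\<kappa> n) * exp (- ((En n - E)\<^sup>2 / (2 * \<epsilon>\<^sub>0\<^sup>2)))) summable_on I"
    and "(\<lambda>(n, k). exp (- ((En n - E)\<^sup>2 / (2 * \<epsilon>\<^sub>0\<^sup>2))) *
           cmod (cinner (\<Omega> (n, k)) (A (\<Omega> (n, k))))) summable_on (eigen_index I \<kappa>)"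
    and "d = (LEAST t. t \<in> (\<lambda>n. \<bar>En n - E\<bar>) ` I)"
    and "M = (\<Sum>n\<in>{n\<in>I. \<bar>En n - E\<bar> = d}. \<kappa> n)"
  shows
    "((\<exists>n\<in>I. \<bar>En n - E\<bar> = d) \<and> (\<forall>n\<in>I. d \<le> \<bar>En n - E\<bar>) \<and>
      finite {n\<in>I. \<bar>En n - E\<bar> = d}) \<and>
     (\<forall>\<epsilon>. 0 < \<epsilon> \<and> \<epsilon> \<le> \<epsilon>\<^sub>0 \<longrightarrow>
       (\<lambda>j. cinner (\<Omega> j) (gaussian_density_op I \<kappa> En \<Omega> E \<epsilon> (A (\<Omega> j))))
         summable_on eigen_index I \<kappa> \<and>
       (\<lambda>j. cinner (\<Omega> j) (gaussian_density_op I \<kappa> En \<Omega> E \<epsilon> (\<Omega> j)))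
         summable_on eigen_index I \<kappa> \<and>
       trace_in (eigen_index I \<kappa>) \<Omega> (gaussian_density_op I \<kappa> En \<Omega> E \<epsilon>) \<noteq> 0) \<and>
     ((\<lambda>\<epsilon>. gaussian_expectation I \<kappa> En \<Omega> E A \<epsilon>) \<longlongrightarrow>
       1 / of_nat M * (\<Sum>n\<in>{n\<in>I. \<bar>En n - E\<bar> = d}. \<Sum>k=1..\<kappa> n.
         cinner (\<Omega> (n, k)) (A (\<Omega> (n, k))))) (at_right 0) \<and>
     (\<forall>n\<^sub>0\<in>I. E = En n\<^sub>0 \<longrightarrow>
       ((\<lambda>\<epsilon>. gaussian_expectation I \<kappa> En \<Omega> E A \<epsilon>) \<longlongrightarrow>
         1 / of_nat (\<kappa> n\<^sub>0) * (\<Sum>k=1..\<kappa> n\<^sub>0.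
           cinner (\<Omega> (n\<^sub>0, k)) (A (\<Omega> (n\<^sub>0, k))))) (at_right 0))"
proof -
  note ons = assms(6) and \<epsilon>0 = assms(10) and smZ = assms(11) and smA = assms(12)
  define J where "J = eigen_index I \<kappa>"
  define x where "x = (\<lambda>n. \<bar>En n - E\<bar>)"
  define a where "a j = cinner (\<Omega> j) (A (\<Omega> j))" for j
  define S where "S = {n\<in>I. x n = d}"
  define g where "g \<epsilon> t = 1 / sqrt (2 * pi * \<epsilon>\<^sup>2) * exp (- (1 / 2) * ((t - E) / \<epsilon>)\<^sup>2)"
    for \<epsilon> t :: real
  have \<kappa>: "\<kappa> n > 0" if "n \<in> I" for n using assms(5) that by blast
  have J: "J = (SIGMA n:I. {1..\<kappa> n})" by (simp add: J_def eigen_index_def)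
  have on: "cinner (\<Omega> i) (\<Omega> j) = (if i = j then 1 else 0)" if "i \<in> J" "j \<in> J" for i j
    using ons that by (simp add: orthonormal_basis_def J_def)

  \<comment> \<open>Every multiplicity is at least 1, so leaving it out only makes the terms
    smaller.\<close>
  have smI: "(\<lambda>n. exp (- ((x n)\<^sup>2 / (2 * \<epsilon>\<^sub>0\<^sup>2)))) summable_on I"
    using smZ by (rule summable_on_comparison_test) (use \<kappa> in \<open>auto simp: x_def Suc_le_eq\<close>)
  \<comment> \<open>A level within distance \<open>r\<close> of \<open>E\<close> has at least the
    weight of a level at distance exactly \<open>r\<close>, and a summable family has only finitely
    many such terms.\<close>
  have fin: "finite {n\<in>I. x n \<le> r}" if "0 \<le> r" for r
  proof (rule finite_subset)
    show "finite {n\<in>I. exp (- (r\<^sup>2 / (2 * \<epsilon>\<^sub>0\<^sup>2))) \<le> exp (- ((x n)\<^sup>2 / (2 * \<epsilon>\<^sub>0\<^sup>2)))}"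
      by (rule finite_large_terms_if_summable[OF smI]) auto
    show "{n\<in>I. x n \<le> r} \<subseteq> {n\<in>I. exp (- (r\<^sup>2 / (2 * \<epsilon>\<^sub>0\<^sup>2))) \<le> exp (- ((x n)\<^sup>2 / (2 * \<epsilon>\<^sub>0\<^sup>2)))}"
      by (auto simp: x_def abs_le_square_iff[symmetric] intro!: divide_right_mono)
  qed
  \<comment> \<open>Over an infinite \<open>I\<close> the infimum might not be attained. The search
    is restricted to the finitely many levels no farther from \<open>E\<close> than an arbitrary
    level \<open>p\<close>; all others are farther than \<open>p\<close>.\<close>
  obtain m where m: "m \<in> I" "\<And>n. n \<in> I \<Longrightarrow> x m \<le> x n"
  proof -
    obtain p where p: "p \<in> I" using assms(3) by blast
    let ?P = "{n\<in>I. x n \<le> x p}"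
    have "finite ?P" by (rule fin) (simp add: x_def)
    then obtain m where "m \<in> ?P" "\<And>n. n \<in> ?P \<Longrightarrow> x m \<le> x n"
      using p arg_min_if_finite(1)[of ?P x] arg_min_least[of ?P _ x]
      by (metis (mono_tags, lifting) empty_iff mem_Collect_eq order_refl)
    then show ?thesis using that by force
  qed
  have d: "d = x m"
    unfolding assms(13) x_def[symmetric] using m by (intro Least_equality) auto
  have dmin: "d \<le> x n" if "n \<in> I" for n using m(2) that by (simp add: d)
  have d0: "0 \<le> d" by (simp add: d x_def)
  have finS: "finite S"
    unfolding S_def using fin[OF d0] by (rule finite_subset[rotated]) auto
  have S: "m \<in> S" using m d by (simp add: S_def)
  have JS: "{j\<in>J. x (fst j) = d} = (SIGMA n:S. {1..\<kappa> n})" by (auto simp: J S_def)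
  have finJS: "finite {j\<in>J. x (fst j) = d}" using finS by (simp add: JS)

  \<comment> \<open>Summing over \<open>k\<close> first repeats the weight of level \<open>n\<close>
    exactly \<open>\<kappa> n\<close> times, which gives the assumed series over the levels.\<close>
  have smJ: "(\<lambda>j. exp (- ((x (fst j))\<^sup>2 / (2 * \<epsilon>\<^sub>0\<^sup>2)))) summable_on J"
    unfolding J
  proof (rule summable_on_SigmaI)
    show "((\<lambda>k. exp (- ((x (fst (n, k)))\<^sup>2 / (2 * \<epsilon>\<^sub>0\<^sup>2)))) has_sum
        real (\<kappa> n) * exp (- ((En n - E)\<^sup>2 / (2 * \<epsilon>\<^sub>0\<^sup>2)))) {1..\<kappa> n}" for n
      by (rule has_sum_finiteI) (auto simp: x_def)
  qed (use smZ in auto)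
  have smJA: "(\<lambda>j. exp (- ((x (fst j))\<^sup>2 / (2 * \<epsilon>\<^sub>0\<^sup>2))) * cmod (a j)) summable_on J"
    using smA by (simp add: J_def a_def x_def case_prod_unfold)

  have g_eq: "g \<epsilon> (En n) = 1 / sqrt (2 * pi * \<epsilon>\<^sup>2) * exp (- ((x n)\<^sup>2 / (2 * \<epsilon>\<^sup>2)))" for \<epsilon> n
    by (simp add: g_def x_def power_divide)
  have g_pos: "0 < g \<epsilon> t" if "0 < \<epsilon>" for \<epsilon> t using that by (simp add: g_def)
  have g_le: "g \<epsilon> (En n) \<le> 1 / sqrt (2 * pi * \<epsilon>\<^sup>2) * exp (- ((x n)\<^sup>2 / (2 * \<epsilon>\<^sub>0\<^sup>2)))"
    if "0 < \<epsilon>" "\<epsilon> \<le> \<epsilon>\<^sub>0" for \<epsilon> n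
    unfolding g_eq using that by (intro mult_left_mono exp_neg_divide_mono) auto
  have smg: "(\<lambda>j. g \<epsilon> (En (fst j))) summable_on J" if "0 < \<epsilon>" "\<epsilon> \<le> \<epsilon>\<^sub>0" for \<epsilon>
    by (rule summable_on_comparison_test[
          OF summable_on_cmult_right[where c = "1 / sqrt (2 * pi * \<epsilon>\<^sup>2)", OF smJ]])
      (use g_le[OF that] g_pos[OF that(1)] in \<open>auto intro: less_imp_le\<close>)
  have smgA: "(\<lambda>j. of_real (g \<epsilon> (En (fst j))) * a j) summable_on J"
    if "0 < \<epsilon>" "\<epsilon> \<le> \<epsilon>\<^sub>0" for \<epsilon>
  proof (rule abs_summable_summable, rule summable_on_comparison_test)
    show "(\<lambda>j. 1 / sqrt (2 * pi * \<epsilon>\<^sup>2) * (exp (- ((x (fst j))\<^sup>2 / (2 * \<epsilon>\<^sub>0\<^sup>2))) * cmod (a j)))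
        summable_on J"
      by (intro summable_on_cmult_right smJA)
    show "norm (of_real (g \<epsilon> (En (fst j))) * a j)
        \<le> 1 / sqrt (2 * pi * \<epsilon>\<^sup>2) * (exp (- ((x (fst j))\<^sup>2 / (2 * \<epsilon>\<^sub>0\<^sup>2))) * cmod (a j))" for j
      using mult_right_mono[OF g_le[OF that, of "fst j"] norm_ge_zero[of "a j"]]
        g_pos[OF \<open>0 < \<epsilon>\<close>, of "En (fst j)"]
      by (simp add: norm_mult mult.assoc)
  qed simp

  let ?\<rho> = "gaussian_density_op I \<kappa> En \<Omega> E"
  \<comment> \<open>Since \<open>y\<close> is arbitrary, \<open>y = A (\<Omega> j)\<close> yields
    the terms of the numerator and \<open>y = \<Omega> j\<close> those of the denominator.\<close>
  have \<rho>: "cinner (\<Omega> j) (?\<rho> \<epsilon> y) = of_real (g \<epsilon> (En (fst j))) * cinner (\<Omega> j) y"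
    if "0 < \<epsilon>" "\<epsilon> \<le> \<epsilon>\<^sub>0" "j \<in> J" for \<epsilon> j y
    unfolding gaussian_density_op_def J_def[symmetric] g_def[symmetric]
    by (rule cinner_spectral_function) (use on that smg g_pos in \<open>auto simp: abs_of_pos\<close>)
  have \<rho>A: "cinner (\<Omega> j) (?\<rho> \<epsilon> (A (\<Omega> j))) = of_real (g \<epsilon> (En (fst j))) * a j"
    if "0 < \<epsilon>" "\<epsilon> \<le> \<epsilon>\<^sub>0" "j \<in> J" for \<epsilon> j
    using \<rho>[OF that] by (simp add: a_def)
  have \<rho>1: "cinner (\<Omega> j) (?\<rho> \<epsilon> (\<Omega> j)) = of_real (g \<epsilon> (En (fst j)))"
    if "0 < \<epsilon>" "\<epsilon> \<le> \<epsilon>\<^sub>0" "j \<in> J" for \<epsilon> j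
    using \<rho>[OF that] on that by simp
  have trA: "trace_in J \<Omega> (?\<rho> \<epsilon> \<circ> A) = (\<Sum>\<^sub>\<infinity>j\<in>J. of_real (g \<epsilon> (En (fst j))) * a j)"
    if "0 < \<epsilon>" "\<epsilon> \<le> \<epsilon>\<^sub>0" for \<epsilon>
    unfolding trace_in_def by (rule infsum_cong) (simp add: \<rho>A that)
  have tr1: "trace_in J \<Omega> (?\<rho> \<epsilon>) = (\<Sum>\<^sub>\<infinity>j\<in>J. of_real (g \<epsilon> (En (fst j))))"
    if "0 < \<epsilon>" "\<epsilon> \<le> \<epsilon>\<^sub>0" for \<epsilon>
    unfolding trace_in_def by (rule infsum_cong) (simp add: \<rho>1 that)

  have summable: "(\<lambda>j. cinner (\<Omega> j) (?\<rho> \<epsilon> (A (\<Omega> j)))) summable_on J \<and>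
      (\<lambda>j. cinner (\<Omega> j) (?\<rho> \<epsilon> (\<Omega> j))) summable_on J \<and> trace_in J \<Omega> (?\<rho> \<epsilon>) \<noteq> 0"
    if \<epsilon>: "0 < \<epsilon>" "\<epsilon> \<le> \<epsilon>\<^sub>0" for \<epsilon>
  proof (intro conjI)
    show "(\<lambda>j. cinner (\<Omega> j) (?\<rho> \<epsilon> (A (\<Omega> j)))) summable_on J"
      using smgA[OF \<epsilon>] by (simp add: \<rho>A \<epsilon> cong: summable_on_cong)
    show "(\<lambda>j. cinner (\<Omega> j) (?\<rho> \<epsilon> (\<Omega> j))) summable_on J"
      using summable_on_of_real[OF smg[OF \<epsilon>]] by (simp add: \<rho>1 \<epsilon> cong: summable_on_cong)
    \<comment> \<open>Labels \<open>k\<close> start at 1 and \<open>\<kappa> m\<close> is positive,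
      so this pair is an index; its single positive term keeps the trace away from 0.\<close>
    have mJ: "(m, 1) \<in> J" using m(1) \<kappa>[OF m(1)] by (simp add: J)
    have "(\<Sum>\<^sub>\<infinity>j\<in>{(m, 1::nat)}. g \<epsilon> (En (fst j))) \<le> infsum (\<lambda>j. g \<epsilon> (En (fst j))) J"
      by (rule infsum_mono2)
        (use smg[OF \<epsilon>] mJ g_pos[OF \<epsilon>(1)] in \<open>auto intro: less_imp_le\<close>)
    then have "infsum (\<lambda>j. g \<epsilon> (En (fst j))) J > 0"
      using g_pos[OF \<epsilon>(1), of "En m"] by simp
    moreover have "trace_in J \<Omega> (?\<rho> \<epsilon>) = of_real (infsum (\<lambda>j. g \<epsilon> (En (fst j))) J)"
      unfolding tr1[OF \<epsilon>]
      by (intro infsumI) (simp add: has_sum_of_real_iff smg[OF \<epsilon>] has_sum_infsum)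
    ultimately show "trace_in J \<Omega> (?\<rho> \<epsilon>) \<noteq> 0" by simp
  qed

  let ?w = "\<lambda>\<epsilon> j. complex_of_real (exp (- (((x (fst j))\<^sup>2 - d\<^sup>2) / (2 * \<epsilon>\<^sup>2))))"
  have expect: "gaussian_expectation I \<kappa> En \<Omega> E A \<epsilon> =
      (\<Sum>\<^sub>\<infinity>j\<in>J. ?w \<epsilon> j * a j) / (\<Sum>\<^sub>\<infinity>j\<in>J. ?w \<epsilon> j * 1)" if \<epsilon>: "0 < \<epsilon>" "\<epsilon> \<le> \<epsilon>\<^sub>0" for \<epsilon>
  proof -
    \<comment> \<open>The normalisation times the Gaussian at the nearest energy. The denominator
      tends to 0 if \<open>d > 0\<close> and to infinity if \<open>d = 0\<close>; cancelling
      \<open>c\<close> leaves sums with finite limits.\<close>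
    define c where "c = complex_of_real (1 / sqrt (2 * pi * \<epsilon>\<^sup>2) * exp (- (d\<^sup>2 / (2 * \<epsilon>\<^sup>2))))"
    have "c \<noteq> 0" using \<epsilon> by (simp add: c_def)
    have gw: "complex_of_real (g \<epsilon> (En (fst j))) = c * ?w \<epsilon> j" for j
    proof -
      have "exp (- ((x (fst j))\<^sup>2 / (2 * \<epsilon>\<^sup>2))) =
          exp (- (d\<^sup>2 / (2 * \<epsilon>\<^sup>2))) * exp (- (((x (fst j))\<^sup>2 - d\<^sup>2) / (2 * \<epsilon>\<^sup>2)))"
        by (simp add: exp_add[symmetric] diff_divide_distrib)
      then show ?thesis unfolding g_eq c_def by (simp only: of_real_mult mult.assoc)
    qed
    show ?thesis
      unfolding gaussian_expectation_def J_def[symmetric] trA[OF \<epsilon>] tr1[OF \<epsilon>] gw mult.assoc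
        infsum_cmult_right'
      using \<open>c \<noteq> 0\<close> by simp
  qed
  have sum_SIGMA: "(\<Sum>j\<in>(SIGMA n:S. {1..\<kappa> n}). f j) = (\<Sum>n\<in>S. \<Sum>k=1..\<kappa> n. f (n, k))"
    for f :: "nat \<times> nat \<Rightarrow> complex"
    using finS by (simp add: sum.Sigma)
  have M_eq: "M = (\<Sum>n\<in>S. \<kappa> n)" using assms(14) by (simp add: S_def x_def)
  \<comment> \<open>The limit of the denominator counts the eigenvectors of the nearest levels;
    being positive, it permits division of the limits.\<close>
  have M: "of_nat M = (\<Sum>j\<in>{j\<in>J. x (fst j) = d}. 1 :: complex)"
    unfolding M_eq JS sum_SIGMA by simp
  have "M > 0"
    unfolding M_eq
    using S finS \<kappa>[OF m(1)] by (intro sum_pos2[of S m]) auto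
  have "((\<lambda>\<epsilon>. (\<Sum>\<^sub>\<infinity>j\<in>J. ?w \<epsilon> j * a j) / (\<Sum>\<^sub>\<infinity>j\<in>J. ?w \<epsilon> j * 1)) \<longlongrightarrow>
      (\<Sum>j\<in>{j\<in>J. x (fst j) = d}. a j) / (\<Sum>j\<in>{j\<in>J. x (fst j) = d}. 1)) (at_right 0)"
  proof (intro tendsto_divide infsum_gaussian_ratio_tendsto[OF _ d0 \<epsilon>0 _ finJS])
    show "d \<le> x (fst j)" "d \<le> x (fst j)" if "j \<in> J" for j
      using that by (auto simp: J dmin)
    show "(\<Sum>j\<in>{j\<in>J. x (fst j) = d}. 1 :: complex) \<noteq> 0"
      using \<open>M > 0\<close> unfolding M[symmetric] by simp
  qed (use smJ smJA in simp_all)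
  \<comment> \<open>The quotient formula is available up to width \<open>\<epsilon>\<^sub>0\<close>,
    which suffices for a limit at 0.\<close>
  moreover have "\<forall>\<^sub>F \<epsilon> in at_right 0. (\<Sum>\<^sub>\<infinity>j\<in>J. ?w \<epsilon> j * a j) / (\<Sum>\<^sub>\<infinity>j\<in>J. ?w \<epsilon> j * 1) =
      gaussian_expectation I \<kappa> En \<Omega> E A \<epsilon>"
    using \<epsilon>0 by (auto simp: eventually_at_right_field expect intro!: exI[of _ \<epsilon>\<^sub>0])
  ultimately have lim: "((\<lambda>\<epsilon>. gaussian_expectation I \<kappa> En \<Omega> E A \<epsilon>) \<longlongrightarrow>
      1 / of_nat M * (\<Sum>n\<in>S. \<Sum>k=1..\<kappa> n. a (n, k))) (at_right 0)"
    unfolding JS sum_SIGMA by (simp add: tendsto_cong M_eq)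
  have "((\<lambda>\<epsilon>. gaussian_expectation I \<kappa> En \<Omega> E A \<epsilon>) \<longlongrightarrow>
      1 / of_nat (\<kappa> n\<^sub>0) * (\<Sum>k=1..\<kappa> n\<^sub>0. a (n\<^sub>0, k))) (at_right 0)"
    if n0: "n\<^sub>0 \<in> I" "E = En n\<^sub>0" for n\<^sub>0
  proof -
    \<comment> \<open>At an eigenvalue the minimal distance is 0, and since distinct indices carry
      distinct energies only the level \<open>n\<^sub>0\<close> remains in \<open>S\<close>.\<close>
    have "d = 0" using dmin[OF n0(1)] d0 n0(2) by (simp add: x_def)
    moreover have "inj_on En I"
      using assms(4) by (auto simp: bij_betw_def inj_on_def)
    ultimately have "S = {n\<^sub>0}" using n0 by (auto simp: S_def x_def inj_on_def)
    moreover have "M = \<kappa> n\<^sub>0"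
      unfolding M_eq \<open>S = {n\<^sub>0}\<close> by simp
    ultimately show ?thesis using lim by simp
  qed
  then show ?thesis
    using m d dmin finS summable lim unfolding S_def J_def x_def a_def by blast
qed

end
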